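(* Suppose that $f$ is $l_f$-smooth and coercive (that is, $\lim_{\|w\|\to\infty}f(w)=\infty$), that $A$ is full row rank with $\gamma:=\sqrt{\theta_{\min}(AA^\top)}>0$, and that for the given $\mu>0$ the parameters satisfy $$\rho>\max\left\{\frac{16(c_1^2+c_2^2)}{\mu},\frac{6l_f}{\gamma^2}\right\},\quad \alpha=\frac1\rho,\quad \beta:=\frac{8c_2^2}{\rho},\quad \eta>\frac{4}{\rho\gamma^2},\quad \frac{\epsilon_{k+1}}{\epsilon_k}\le\sqrt{\frac{\rho\gamma^2\eta-4}{\rho\gamma^2\eta+4}}\ \ \forall k,$$ where $c_1:=(\mu+l_f)/\gamma$ and $c_2:=\mu/\gamma$. Let $\{(w^k;u^k;z^k;v^k)\}_{k\in\mathbb{N}}$ be a sequence generated by IALM satisfying the stopping criteria (a) and (b), and let $(w^*;u^*;z^*;v^* )$ be an accumulation point of $\{(w^k;u^k;z^k;v^k)\}_{k\in\mathbb{N}}$. Then $v^*=w^*$ and $(w^*;u^*;z^* )$ is a P-stationary triplet of the problem $$\min_{w\in\mathbb{R}^p,\,u\in\mathbb{R}^n} f(w)+\lambda\|u_+\|_0\quad\text{s.t.}\quad Aw+b=u.\qquad(\mathrm{O})$$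
   Context: Setting: $f:\mathbb{R}^p\to\mathbb{R}$ is continuously differentiable, $A\in\mathbb{R}^{n\times p}$, $b\in\mathbb{R}^n$, $\lambda,\rho,\mu>0$. A function is $l$-smooth if its gradient is Lipschitz continuous with constant $l$; $\theta_{\min}$ is the smallest eigenvalue. For $u\in\mathbb{R}^n$, $u_+:=(\max\{0,u_i\})_i$ and $\|u\|_0$ counts nonzero components. $(w;u)$ denotes concatenation; $\|x\|_P^2:=x^\top Px$; ${\rm dist}(u,\Theta):=\inf_{\theta\in\Theta}\|u-\theta\|$. Lyapunov function: $\mathcal{V}_{\rho,\mu}(w,u,z,v):=f(w)+\lambda\|u_+\|_0+\langle z,Aw+b-u\rangle+\frac{\rho}{2}\|Aw+b-u\|^2+\frac{\mu}{2}\|w-v\|^2$. Proximal operator (set-valued): ${\rm Prox}_{\alpha\lambda\|(\cdot)_+\|_0}(z):=\arg\min_{u\in\mathbb{R}^n}\ \lambda\|u_+\|_0+\frac{1}{2\alpha}\|u-z\|^2$. $(w^*;u^*;z^* )$ is a P-stationary triplet of (O) if there is a constant $\alpha>0$ with $\nabla f(w^* )+A^\top z^*=0$, $u^*\in{\rm Prox}_{\alpha\lambda\|(\cdot)_+\|_0}(u^*+\alpha z^* )$, $Aw^*+b-u^*=0$. IALM (inexact augmented Lagrangian method): given a positive sequence $\{\epsilon_k\}_{k\in\mathbb{N}}$, fixed $\mu>0$, $\rho>0$, $\alpha=1/\rho$, start with any $(w^0;u^0;z^0;v^0)\in\mathbb{R}^p\times\mathbb{R}^n\times\mathbb{R}^n\times\mathbb{R}^p$.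 With $h_k(w,u):=f(w)+\frac{\mu}{2}\|w-v^k\|^2+\langle z^k,Aw+b-u\rangle+\frac{\rho}{2}\|Aw+b-u\|^2$, for $k=0,1,\dots$: Primal step: use the inner solver 0/1-BALM to compute $(w^{k+1};u^{k+1})$ as an approximate solution of $\min_{w,u}\mathcal{V}_{\rho,\mu}(w,u,z^k,v^k)$ satisfying the stopping criteria (a) $\mathcal{V}_{\rho,\mu}(w^{k+1},u^{k+1},z^k,v^k)\le\mathcal{V}_{\rho,\mu}(w^k,u^k,z^k,v^k)$, (b) $\max\big\{{\rm dist}\big(u^{k+1},{\rm Prox}_{\alpha\lambda\|(\cdot)_+\|_0}(u^{k+1}-\alpha\nabla_uh_k(w^{k+1},u^{k+1}))\big),\ \|\nabla_wh_k(w^{k+1},u^{k+1})\|\big\}\le\epsilon_k$. Multiplier step: $z^{k+1}=z^k+\rho(Aw^{k+1}+b-u^{k+1})$. Lyapunov step: $v^{k+1}=w^{k+1}$. Inner solver 0/1-BALM: let $t>0$, $Q_{k,j}$ symmetric positive semidefinite, $P_{k,j}:=tI-Q_{k,j}$, $g:\mathbb{R}^p\to\mathbb{R}$ $l_g$-smooth, $\psi_{k,j}(w):=\frac12\|w\|_{P_{k,j}}^2-g(w)$, and $\mathcal{D}_{\psi_{k,j}}(w,w^{k,j}):=\psi_{k,j}(w)-\psi_{k,j}(w^{k,j})-\langle\nabla\psi_{k,j}(w^{k,j}),w-w^{k,j}\rangle$. Starting from $(w^{k,0};u^{k,0})=(w^k;u^k)$, for $j=0,1,\dots$ take $u^{k,j+1}\in{\rm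 Prox}_{\alpha\lambda\|(\cdot)_+\|_0}(u^{k,j}-\alpha\nabla_uh_k(w^{k,j},u^{k,j}))$ and $w^{k,j+1}\in\arg\min_w h_k(w,u^{k,j+1})+\mathcal{D}_{\psi_{k,j}}(w,w^{k,j})$; $(w^{k+1};u^{k+1})$ is an iterate satisfying (a) and (b). *)

theory Defs
  imports "HOL-Analysis.Analysis"
begin

text \<open>
  If the gradient does not exist, \<open>grad f x\<close> is unspecified; differentiability is
  therefore demanded explicitly wherever it is assumed.
\<close>

definition grad :: "('a::real_inner \<Rightarrow> real) \<Rightarrow> 'a \<Rightarrow> 'a" where
  "grad f x = (THE D. GDERIV f x :> D)"

definition continuously_differentiable :: "('a::real_inner \<Rightarrow> real) \<Rightarrow> bool" where
  "continuously_differentiable f \<longleftrightarrow> (\<forall>x. f differentiable at x) \<and> continuous_on UNIV (grad f)"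

definition l_smooth :: "real \<Rightarrow> ('a::real_inner \<Rightarrow> real) \<Rightarrow> bool" where
  "l_smooth l f \<longleftrightarrow> (\<forall>x. f differentiable at x) \<and> l-lipschitz_on UNIV (grad f)"

definition coercive :: "('a::real_normed_vector \<Rightarrow> real) \<Rightarrow> bool" where
  "coercive f \<longleftrightarrow> filterlim f at_top at_infinity"

definition is_eigenvalue :: "real^'n^'n \<Rightarrow> real \<Rightarrow> bool" where
  "is_eigenvalue M \<theta> \<longleftrightarrow> (\<exists>x. x \<noteq> 0 \<and> M *v x = \<theta> *\<^sub>R x)"

definition min_eigenvalue :: "real^'n^'n \<Rightarrow> real" where
  "min_eigenvalue M = (LEAST \<theta>. is_eigenvalue M \<theta>)"

definition sym_psd :: "real^'n^'n \<Rightarrow> bool" where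
  "sym_psd M \<longleftrightarrow> transpose M = M \<and> (\<forall>x. 0 \<le> x \<bullet> (M *v x))"

definition pos_part :: "real^'n \<Rightarrow> real^'n" where
  "pos_part u = (\<chi> i. max 0 (u $ i))"

definition l0_norm :: "real^'n \<Rightarrow> nat" where
  "l0_norm u = card {i. u $ i \<noteq> 0}"

definition prox_pos_l0 :: "real \<Rightarrow> real \<Rightarrow> real^'n \<Rightarrow> (real^'n) set" where
  "prox_pos_l0 \<alpha> lam z =
     {u. is_arg_min (\<lambda>u. lam * real (l0_norm (pos_part u)) + 1 / (2 * \<alpha>) * (norm (u - z))\<^sup>2)
           (\<lambda>_. True) u}"

definition lyapunov ::
  "(real^'p \<Rightarrow> real) \<Rightarrow> real^'p^'n \<Rightarrow> real^'n \<Rightarrow> real \<Rightarrow> real \<Rightarrow> real \<Rightarrow>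
   real^'p \<Rightarrow> real^'n \<Rightarrow> real^'n \<Rightarrow> real^'p \<Rightarrow> real" where
  "lyapunov f A b lam \<rho> \<mu> w u z v =
     f w + lam * real (l0_norm (pos_part u)) + z \<bullet> (A *v w + b - u)
     + \<rho> / 2 * (norm (A *v w + b - u))\<^sup>2 + \<mu> / 2 * (norm (w - v))\<^sup>2"

text \<open>The function $h_k$ is \<open>smooth_part f A b \<rho> \<mu> (z k) (v k)\<close>.\<close>

definition smooth_part ::
  "(real^'p \<Rightarrow> real) \<Rightarrow> real^'p^'n \<Rightarrow> real^'n \<Rightarrow> real \<Rightarrow> real \<Rightarrow>
   real^'n \<Rightarrow> real^'p \<Rightarrow> real^'p \<Rightarrow> real^'n \<Rightarrow> real" where
  "smooth_part f A b \<rho> \<mu> z v w u =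
     f w + \<mu> / 2 * (norm (w - v))\<^sup>2 + z \<bullet> (A *v w + b - u)
     + \<rho> / 2 * (norm (A *v w + b - u))\<^sup>2"

definition grad_w :: "('a::real_inner \<Rightarrow> 'b \<Rightarrow> real) \<Rightarrow> 'a \<Rightarrow> 'b \<Rightarrow> 'a" where
  "grad_w h w u = grad (\<lambda>x. h x u) w"

definition grad_u :: "('a \<Rightarrow> 'b::real_inner \<Rightarrow> real) \<Rightarrow> 'a \<Rightarrow> 'b \<Rightarrow> 'b" where
  "grad_u h w u = grad (\<lambda>y. h w y) u"

text \<open>Here \<open>mat t\<close> is the matrix $t I$.\<close>

definition bregman_kernel :: "real \<Rightarrow> real^'p^'p \<Rightarrow> (real^'p \<Rightarrow> real) \<Rightarrow> real^'p \<Rightarrow> real" where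
  "bregman_kernel t Q g w = 1 / 2 * (w \<bullet> ((mat t - Q) *v w)) - g w"

definition bregman_distance :: "('a::real_inner \<Rightarrow> real) \<Rightarrow> 'a \<Rightarrow> 'a \<Rightarrow> real" where
  "bregman_distance \<psi> x y = \<psi> x - \<psi> y - grad \<psi> y \<bullet> (x - y)"

text \<open>
  \<open>W\<close> and \<open>U\<close> are the iterates of the inner solver up to index \<open>J\<close>, applied to the function
  \<open>h\<close> with matrices \<open>Q 0\<close>, \<open>Q 1\<close>, \dots; their values beyond \<open>J\<close> are irrelevant.
\<close>

definition balm_run ::
  "(real^'p \<Rightarrow> real^'n \<Rightarrow> real) \<Rightarrow> real \<Rightarrow> real \<Rightarrow> real \<Rightarrow> (nat \<Rightarrow> real^'p^'p) \<Rightarrow>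
   (real^'p \<Rightarrow> real) \<Rightarrow> real^'p \<Rightarrow> real^'n \<Rightarrow>
   (nat \<Rightarrow> real^'p) \<Rightarrow> (nat \<Rightarrow> real^'n) \<Rightarrow> nat \<Rightarrow> bool" where
  "balm_run h lam \<alpha> t Q g w0 u0 W U J \<longleftrightarrow>
     W 0 = w0 \<and> U 0 = u0 \<and>
     (\<forall>j<J.
        U (Suc j) \<in> prox_pos_l0 \<alpha> lam (U j - \<alpha> *\<^sub>R grad_u h (W j) (U j)) \<and>
        is_arg_min (\<lambda>w. h w (U (Suc j)) + bregman_distance (bregman_kernel t (Q j) g) w (W j))
          (\<lambda>_. True) (W (Suc j)))"

text \<open>
  The pair \<open>(w (Suc k), u (Suc k))\<close> is an iterate of the inner solver, started at
  \<open>(w k, u k)\<close>, that meets the two stopping criteria with tolerance \<open>\<epsilon> k\<close>.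
  The distance to a set is \<open>infdist\<close>; its special value for the empty set plays no role, since
  the proximal operator is nonempty-valued for positive parameters.
\<close>

definition ialm_primal_step ::
  "(real^'p \<Rightarrow> real) \<Rightarrow> real^'p^'n \<Rightarrow> real^'n \<Rightarrow> real \<Rightarrow> real \<Rightarrow> real \<Rightarrow> real \<Rightarrow>
   real \<Rightarrow> (nat \<Rightarrow> nat \<Rightarrow> real^'p^'p) \<Rightarrow> (real^'p \<Rightarrow> real) \<Rightarrow> (nat \<Rightarrow> real) \<Rightarrow>
   (nat \<Rightarrow> real^'p) \<Rightarrow> (nat \<Rightarrow> real^'n) \<Rightarrow> (nat \<Rightarrow> real^'n) \<Rightarrow> (nat \<Rightarrow> real^'p) \<Rightarrow> nat \<Rightarrow> bool" where
  "ialm_primal_step f A b lam \<rho> \<mu> \<alpha> t Q g \<epsilon> w u z v k \<longleftrightarrow>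
     (let h = smooth_part f A b \<rho> \<mu> (z k) (v k) in
        (\<exists>W U J. balm_run h lam \<alpha> t (Q k) g (w k) (u k) W U J \<and>
                 w (Suc k) = W J \<and> u (Suc k) = U J) \<and>
        lyapunov f A b lam \<rho> \<mu> (w (Suc k)) (u (Suc k)) (z k) (v k)
          \<le> lyapunov f A b lam \<rho> \<mu> (w k) (u k) (z k) (v k) \<and>
        max (infdist (u (Suc k))
               (prox_pos_l0 \<alpha> lam (u (Suc k) - \<alpha> *\<^sub>R grad_u h (w (Suc k)) (u (Suc k)))))
            (norm (grad_w h (w (Suc k)) (u (Suc k)))) \<le> \<epsilon> k)"

definition ialm_sequence ::
  "(real^'p \<Rightarrow> real) \<Rightarrow> real^'p^'n \<Rightarrow> real^'n \<Rightarrow> real \<Rightarrow> real \<Rightarrow> real \<Rightarrow> real \<Rightarrow>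
   real \<Rightarrow> (nat \<Rightarrow> nat \<Rightarrow> real^'p^'p) \<Rightarrow> (real^'p \<Rightarrow> real) \<Rightarrow> (nat \<Rightarrow> real) \<Rightarrow>
   (nat \<Rightarrow> real^'p) \<Rightarrow> (nat \<Rightarrow> real^'n) \<Rightarrow> (nat \<Rightarrow> real^'n) \<Rightarrow> (nat \<Rightarrow> real^'p) \<Rightarrow> bool" where
  "ialm_sequence f A b lam \<rho> \<mu> \<alpha> t Q g \<epsilon> w u z v \<longleftrightarrow>
     (\<forall>k. ialm_primal_step f A b lam \<rho> \<mu> \<alpha> t Q g \<epsilon> w u z v k \<and>
          z (Suc k) = z k + \<rho> *\<^sub>R (A *v w (Suc k) + b - u (Suc k)) \<and>
          v (Suc k) = w (Suc k))"

definition accumulation_point :: "(nat \<Rightarrow> 'a::metric_space) \<Rightarrow> 'a \<Rightarrow> bool" where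
  "accumulation_point X x \<longleftrightarrow> (\<exists>r. strict_mono r \<and> (X \<circ> r) \<longlonglongrightarrow> x)"

definition P_stationary ::
  "(real^'p \<Rightarrow> real) \<Rightarrow> real^'p^'n \<Rightarrow> real^'n \<Rightarrow> real \<Rightarrow> real^'p \<Rightarrow> real^'n \<Rightarrow> real^'n \<Rightarrow> bool" where
  "P_stationary f A b lam w u z \<longleftrightarrow>
     (\<exists>\<alpha>>0. grad f w + transpose A *v z = 0 \<and>
             u \<in> prox_pos_l0 \<alpha> lam (u + \<alpha> *\<^sub>R z) \<and>
             A *v w + b - u = 0)"

end

theory Submission
  imports Defs
begin

text \<open>
  Write \<open>D k = \<parallel>w (k + 1) - v k\<parallel>\<close>. After the multiplier step, the gradient part of the stopping
  criterion says that \<open>\<nabla>f (w (k + 1)) + \<mu> (w (k + 1) - v k) + A\<^sup>T z (k + 1)\<close> has norm at most \<open>\<epsilon> k\<close>.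
  Two consecutive relations of this kind, the Lipschitz gradient and \<open>\<gamma> \<parallel>x\<parallel> \<le> \<parallel>A\<^sup>T x\<parallel>\<close>
  (\<open>norm_transpose_lower_bound\<close>) control the multiplier by the primal iterates:
  \<open>\<parallel>z (k + 2) - z (k + 1)\<parallel> \<le> c1 D (k + 1) + c2 D k + (\<epsilon> (k + 1) + \<epsilon> k) / \<gamma>\<close>
  (\<open>multiplier_change_le\<close>).

  The multiplier step raises the Lyapunov function by the square of this change over \<open>\<rho>\<close>, while the
  update of \<open>v\<close> lowers it by \<open>\<mu> / 2 (D (k + 1))\<^sup>2\<close> (\<open>lyapunov_after_updates\<close>). For large \<open>\<rho>\<close> the
  gain wins: adding \<open>4 c2\<^sup>2 / \<rho> (D k)\<^sup>2\<close> to the Lyapunov function absorbs the delayed term and gives a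
  potential that decreases by a multiple of \<open>(D (k + 1))\<^sup>2\<close>, up to errors that are summable because
  the tolerances decay geometrically.

  The accumulation point itself bounds the potential below: along the convergent subsequence the
  smooth part converges and the counting term is nonnegative. By \<open>perturbed_descent_summable\<close> the
  squares of \<open>D\<close> are summable, so \<open>D\<close>, the multiplier changes and hence the residuals
  \<open>A w + b - u\<close> tend to 0 along the whole sequence. Passing to the limit along the subsequence yields
  feasibility and the gradient equation. Since the gradient in \<open>u\<close> equals \<open>- z (k + 1)\<close>, the remaining
  part of the stopping criterion says that \<open>u (k + 1)\<close> is nearly in the proximal set at
  \<open>u (k + 1) + \<alpha> z (k + 1)\<close>, and the closed graph of the proximal operator
  (\<open>prox_pos_l0_closed_graph\<close>) carries this to the limit.
\<close>

section \<open>Gradients\<close>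

lemma grad_eqI:
  fixes f :: "'a::real_inner \<Rightarrow> real"
  assumes "GDERIV f x :> D"
  shows "grad f x = D"
proof -
  have "D' = D" if "GDERIV f x :> D'" for D'
  proof -
    have "(\<lambda>h. h \<bullet> D') = (\<lambda>h. h \<bullet> D)"
      using that assms has_derivative_unique unfolding gderiv_def by blast
    then show ?thesis by (metis vector_eq_ldot)
  qed
  with assms show ?thesis unfolding grad_def by (rule the_equality)
qed

lemma GDERIV_grad:
  fixes f :: "'a::euclidean_space \<Rightarrow> real"
  assumes "f differentiable at x"
  shows "GDERIV f x :> grad f x"
proof -
  obtain D where D: "(f has_derivative D) (at x)"
    using assms unfolding differentiable_def by blast
  \<comment> \<open>The adjoint of the derivative, applied to 1, is the Riesz representative of the derivative.\<close>
  have "D = (\<lambda>h. h \<bullet> adjoint D 1)"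
    using adjoint_works[OF has_derivative_linear[OF D], of _ 1] by auto
  with D have "GDERIV f x :> adjoint D 1" unfolding gderiv_def by simp
  then show ?thesis using grad_eqI by metis
qed

lemma inner_transpose_matrix:
  fixes A :: "real^'p^'n"
  shows "h \<bullet> (transpose A *v y) = y \<bullet> (A *v h)"
  by (metis dot_lmul_matrix inner_commute transpose_matrix_vector)

text \<open>
  The multiplier term and the quadratic penalty are differentiated together: their gradients combine
  into \<open>z + \<rho> (A w + b - u)\<close>, which is the multiplier after its update.
\<close>

lemma grad_w_smooth_part:
  fixes f :: "real^'p \<Rightarrow> real" and A :: "real^'p^'n"
  assumes "f differentiable at w"
  shows "grad_w (smooth_part f A b \<rho> \<mu> z v) w u
           = grad f w + \<mu> *\<^sub>R (w - v) + transpose A *v (z + \<rho> *\<^sub>R (A *v w + b - u))"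
proof -
  have f: "(f has_derivative (\<lambda>h. h \<bullet> grad f w)) (at w)"
    using GDERIV_grad[OF assms] unfolding gderiv_def .
  have A: "((\<lambda>x. A *v x) has_derivative (\<lambda>h. A *v h)) (at w)"
    by (rule bounded_linear_imp_has_derivative) simp
  have "GDERIV (\<lambda>x. smooth_part f A b \<rho> \<mu> z v x u) w :>
          grad f w + \<mu> *\<^sub>R (w - v) + transpose A *v (z + \<rho> *\<^sub>R (A *v w + b - u))"
    unfolding gderiv_def smooth_part_def power2_norm_eq_inner
    by (rule has_derivative_eq_rhs, (rule f A derivative_intros)+)
       (auto simp: fun_eq_iff inner_transpose_matrix inner_add_left inner_add_right
         inner_diff_left inner_diff_right inner_commute algebra_simps
         simp del: transpose_matrix_vector)
  then show ?thesis unfolding grad_w_def by (rule grad_eqI)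
qed

lemma grad_u_smooth_part:
  fixes A :: "real^'p^'n"
  shows "grad_u (smooth_part f A b \<rho> \<mu> z v) w u = - (z + \<rho> *\<^sub>R (A *v w + b - u))"
proof -
  have "GDERIV (\<lambda>y. smooth_part f A b \<rho> \<mu> z v w y) u :> - (z + \<rho> *\<^sub>R (A *v w + b - u))"
    unfolding gderiv_def smooth_part_def power2_norm_eq_inner
    by (rule has_derivative_eq_rhs, (rule derivative_intros)+)
       (auto simp: fun_eq_iff inner_add_left inner_add_right
         inner_diff_left inner_diff_right inner_commute algebra_simps)
  then show ?thesis unfolding grad_u_def by (rule grad_eqI)
qed

section \<open>The smallest eigenvalue of a symmetric matrix\<close>

lemma psd_form_zero_imp_kernel:
  fixes B :: "real^'n^'n"
  assumes sym: "transpose B = B" and psd: "\<And>y. 0 \<le> y \<bullet> (B *v y)" and zero: "x \<bullet> (B *v x) = 0"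
  shows "B *v x = 0"
proof -
  define y where "y = B *v x"
  define a c where "a = y \<bullet> y" and "c = y \<bullet> (B *v y)"
  have xy: "x \<bullet> (B *v y) = a"
    using inner_transpose_matrix[of x B y] unfolding sym by (simp add: y_def a_def)
  have quadratic: "0 \<le> 2 * s * a + s\<^sup>2 * c" for s
    using psd[of "x + s *\<^sub>R y"] zero xy
    by (simp add: matrix_vector_right_distrib matrix_vector_mult_scaleR inner_add_left
        inner_add_right a_def c_def power2_eq_square algebra_simps flip: y_def)
  \<comment> \<open>At \<open>s = - a / (c + 1)\<close>, close enough to 0 for the linear term to dominate, the quadratic is
    negative unless \<open>a = 0\<close>.\<close>
  define k where "k = c + 1"
  have k: "k \<ge> 1" using psd[of y] by (simp add: k_def c_def)
  have "0 \<le> (2 * (- a / k) * a + (- a / k)\<^sup>2 * (k - 1)) * k\<^sup>2"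
    by (rule mult_nonneg_nonneg) (use quadratic[of "- a / k"] in \<open>simp_all add: k_def\<close>)
  also have "(2 * (- a / k) * a + (- a / k)\<^sup>2 * (k - 1)) * k\<^sup>2 = - (a\<^sup>2 * (k + 1))"
    using k by (simp add: field_simps power2_eq_square)
  finally have "a\<^sup>2 * (k + 1) \<le> 0" by simp
  then have "a\<^sup>2 \<le> 0"
    using k by (simp add: mult_le_0_iff)
  then show ?thesis by (simp add: a_def y_def)
qed

text \<open>
  The minimum of the Rayleigh quotient is attained on the unit sphere. Subtracting it from \<open>M\<close>
  leaves a positive semidefinite matrix whose form vanishes at the minimiser, so the minimiser is an
  eigenvector and the minimum is the least eigenvalue.
\<close>

lemma min_eigenvalue_le_quadratic_form:
  fixes M :: "real^'n^'n"
  assumes sym: "transpose M = M"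
  shows "min_eigenvalue M * (norm x)\<^sup>2 \<le> x \<bullet> (M *v x)"
proof -
  have "continuous_on (sphere 0 1) (\<lambda>x. x \<bullet> (M *v x))"
    by (intro continuous_intros)
  moreover have "axis i 1 \<in> sphere (0::real^'n) 1" for i
    by (simp add: norm_axis_1)
  then have "sphere (0::real^'n) 1 \<noteq> {}" by blast
  ultimately obtain x0 where x0: "norm x0 = 1"
    and min: "\<And>y. norm y = 1 \<Longrightarrow> x0 \<bullet> (M *v x0) \<le> y \<bullet> (M *v y)"
    using continuous_attains_inf[of "sphere 0 1" "\<lambda>x. x \<bullet> (M *v x)"]
    by (auto simp: dist_norm)
  define m where "m = x0 \<bullet> (M *v x0)"
  have form: "m * (y \<bullet> y) \<le> y \<bullet> (M *v y)" for y
  proof (cases "y = 0")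
    case False
    have "m \<le> (y /\<^sub>R norm y) \<bullet> (M *v (y /\<^sub>R norm y))"
      unfolding m_def by (rule min) (use False in simp)
    also have "\<dots> = (y \<bullet> (M *v y)) / (y \<bullet> y)"
      by (simp add: matrix_vector_mult_scaleR dot_square_norm power2_eq_square field_simps)
    finally show ?thesis using False by (simp add: field_simps)
  qed simp
  have shift: "(M - mat m) *v y = M *v y - m *\<^sub>R y" for y
  proof -
    have "mat m *v y = m *\<^sub>R y"
      by (simp add: vec_eq_iff matrix_vector_mult_def mat_def if_distrib[where f="\<lambda>a. a * _"]
          cong: if_cong)
    then show ?thesis by (simp add: matrix_vector_mult_diff_rdistrib)
  qed
  have "(M - mat m) *v x0 = 0"
  proof (rule psd_form_zero_imp_kernel)
    show "transpose (M - mat m) = M - mat m"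
      using sym by (auto simp: transpose_def vec_eq_iff mat_def)
    show "0 \<le> y \<bullet> ((M - mat m) *v y)" for y
      using form[of y] by (simp add: shift inner_diff_right)
    show "x0 \<bullet> ((M - mat m) *v x0) = 0"
      using x0 by (simp add: shift inner_diff_right dot_square_norm flip: m_def)
  qed
  then have "M *v x0 = m *\<^sub>R x0" by (simp add: shift)
  moreover have "x0 \<noteq> 0" using x0 by auto
  ultimately have "is_eigenvalue M m" unfolding is_eigenvalue_def by blast
  moreover have "m \<le> \<theta>" if eigenvalue: "is_eigenvalue M \<theta>" for \<theta>
  proof -
    obtain y where y: "y \<noteq> 0" and My: "M *v y = \<theta> *\<^sub>R y"
      using eigenvalue unfolding is_eigenvalue_def by blast
    have "m * (y \<bullet> y) \<le> \<theta> * (y \<bullet> y)"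
      using form[of y] unfolding My inner_scaleR_right .
    moreover have "0 < y \<bullet> y" using y by simp
    ultimately show ?thesis by (rule mult_right_le_imp_le)
  qed
  ultimately have "min_eigenvalue M = m"
    unfolding min_eigenvalue_def by (rule Least_equality)
  then show ?thesis using form[of x] by (simp add: dot_square_norm)
qed

lemma norm_transpose_lower_bound:
  fixes A :: "real^'p^'n"
  shows "sqrt (min_eigenvalue (A ** transpose A)) * norm x \<le> norm (transpose A *v x)"
proof -
  have "min_eigenvalue (A ** transpose A) * (norm x)\<^sup>2 \<le> x \<bullet> ((A ** transpose A) *v x)"
    by (rule min_eigenvalue_le_quadratic_form) (simp add: matrix_transpose_mul)
  also have "\<dots> = (norm (transpose A *v x))\<^sup>2"
    using inner_transpose_matrix[of "transpose A *v x" A x]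
    by (simp add: dot_square_norm flip: matrix_vector_mul_assoc del: transpose_matrix_vector)
  finally have "sqrt (min_eigenvalue (A ** transpose A) * (norm x)\<^sup>2) \<le> norm (transpose A *v x)"
    by (simp add: real_le_lsqrt)
  then show ?thesis by (simp add: real_sqrt_mult)
qed

section \<open>The proximal operator of the positive-part counting function\<close>

lemma in_prox_pos_l0_iff:
  "u \<in> prox_pos_l0 \<alpha> lam z \<longleftrightarrow>
     (\<forall>x. lam * real (l0_norm (pos_part u)) + 1 / (2 * \<alpha>) * (norm (u - z))\<^sup>2
          \<le> lam * real (l0_norm (pos_part x)) + 1 / (2 * \<alpha>) * (norm (x - z))\<^sup>2)"
  by (simp add: prox_pos_l0_def is_arg_min_linorder)

lemma l0_norm_pos_part: "l0_norm (pos_part u) = card {i. 0 < u $ i}"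
proof -
  have "{i. pos_part u $ i \<noteq> 0} = {i. 0 < u $ i}" by (auto simp: pos_part_def max_def)
  then show ?thesis by (simp add: l0_norm_def)
qed

text \<open>
  The objective is a sum over the coordinates, and each summand has a minimiser: keep a coordinate
  that is nonpositive or expensive to move, and set the others to zero.
\<close>

lemma prox_pos_l0_nonempty:
  fixes z :: "real^'n"
  assumes lam: "lam \<ge> 0" and \<alpha>: "\<alpha> > 0"
  shows "prox_pos_l0 \<alpha> lam z \<noteq> {}"
proof -
  define \<phi> where "\<phi> i x = (if 0 < x then lam else 0) + 1 / (2 * \<alpha>) * (x - z $ i)\<^sup>2" for i x
  define p :: "real^'n" where
    "p = (\<chi> i. if z $ i \<le> 0 \<or> lam \<le> 1 / (2 * \<alpha>) * (z $ i)\<^sup>2 then z $ i else 0)"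
  have sum: "lam * real (l0_norm (pos_part x)) + 1 / (2 * \<alpha>) * (norm (x - z))\<^sup>2
               = (\<Sum>i\<in>UNIV. \<phi> i (x $ i))" for x :: "real^'n"
  proof -
    have "(\<Sum>i\<in>UNIV. if 0 < x $ i then lam else 0) = lam * real (l0_norm (pos_part x))"
      by (simp add: l0_norm_pos_part sum.If_cases mult.commute)
    moreover have "(norm (x - z))\<^sup>2 = (\<Sum>i\<in>UNIV. (x $ i - z $ i)\<^sup>2)"
      unfolding power2_norm_eq_inner by (simp add: inner_vec_def power2_eq_square)
    ultimately show ?thesis by (simp add: \<phi>_def sum.distrib sum_distrib_left)
  qed
  have "\<phi> i (p $ i) \<le> \<phi> i x" for i x
  proof -
    have nonneg: "0 \<le> 1 / (2 * \<alpha>) * (x - z $ i)\<^sup>2" using \<alpha> by simp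
    have far: "1 / (2 * \<alpha>) * (z $ i)\<^sup>2 \<le> 1 / (2 * \<alpha>) * (x - z $ i)\<^sup>2" if "x \<le> 0" "0 < z $ i"
      using that \<alpha> by (intro mult_left_mono abs_le_square_iff[THEN iffD1]) auto
    show ?thesis using nonneg far lam by (auto simp: \<phi>_def p_def)
  qed
  then have "p \<in> prox_pos_l0 \<alpha> lam z"
    unfolding in_prox_pos_l0_iff sum by (auto intro: sum_mono)
  then show ?thesis by blast
qed

text \<open>
  Strictly positive coordinates stay positive nearby, so the counting term is lower semicontinuous
  and survives the limit as the smaller side of the minimality inequality.
\<close>

lemma prox_pos_l0_closed_graph:
  fixes p y :: "nat \<Rightarrow> real^'n"
  assumes lam: "lam \<ge> 0" and mem: "\<And>k. p k \<in> prox_pos_l0 \<alpha> lam (y k)"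
    and p: "p \<longlonglongrightarrow> p'" and y: "y \<longlonglongrightarrow> y'"
  shows "p' \<in> prox_pos_l0 \<alpha> lam y'"
  unfolding in_prox_pos_l0_iff
proof
  fix x :: "real^'n"
  let ?c = "\<lambda>u :: real^'n. lam * real (l0_norm (pos_part u))"
  let ?q = "\<lambda>u v :: real^'n. 1 / (2 * \<alpha>) * (norm (u - v))\<^sup>2"
  have "\<forall>\<^sub>F k in sequentially. 0 < p' $ i \<longrightarrow> 0 < p k $ i" for i
    using order_tendstoD(1)[OF tendsto_vec_nth[OF p], of 0 i]
    by (cases "0 < p' $ i") auto
  then have "\<forall>\<^sub>F k in sequentially. \<forall>i. 0 < p' $ i \<longrightarrow> 0 < p k $ i"
    by (rule eventually_all_finite)
  then have "\<forall>\<^sub>F k in sequentially. ?c p' + ?q (p k) (y k) \<le> ?c x + ?q x (y k)"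
  proof eventually_elim
    case (elim k)
    then have "l0_norm (pos_part p') \<le> l0_norm (pos_part (p k))"
      unfolding l0_norm_pos_part by (intro card_mono) auto
    then have "?c p' \<le> ?c (p k)" using lam by (simp add: mult_left_mono)
    with mem[of k] show ?case unfolding in_prox_pos_l0_iff by (smt (verit))
  qed
  moreover have "(\<lambda>k. ?c p' + ?q (p k) (y k)) \<longlonglongrightarrow> ?c p' + ?q p' y'"
    by (intro tendsto_intros p y)
  moreover have "(\<lambda>k. ?c x + ?q x (y k)) \<longlonglongrightarrow> ?c x + ?q x y'"
    by (intro tendsto_intros y)
  ultimately show "?c p' + ?q p' y' \<le> ?c x + ?q x y'"
    using tendsto_le[OF sequentially_bot] by blast
qed

lemma approximate_prox_fixed_point_limit:
  fixes x y :: "nat \<Rightarrow> real^'n"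
  assumes lam: "lam \<ge> 0" and \<alpha>: "\<alpha> > 0"
    and dist: "\<And>k. infdist (x k) (prox_pos_l0 \<alpha> lam (y k)) \<le> e k"
    and e: "e \<longlonglongrightarrow> 0" and x: "x \<longlonglongrightarrow> x'" and y: "y \<longlonglongrightarrow> y'"
  shows "x' \<in> prox_pos_l0 \<alpha> lam y'"
proof -
  \<comment> \<open>The slack \<open>1 / (k + 1)\<close> provides points of the proximal sets at nearly minimal distance.\<close>
  have "\<exists>q \<in> prox_pos_l0 \<alpha> lam (y k). dist (x k) q < e k + 1 / Suc k" for k
  proof -
    have "infdist (x k) (prox_pos_l0 \<alpha> lam (y k)) < e k + 1 / Suc k"
      using dist[of k] by (rule order_le_less_trans) simp
    then show ?thesis
      using prox_pos_l0_nonempty[OF lam \<alpha>, of "y k"]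
      by (simp add: infdist_notempty cInf_less_iff)
  qed
  then obtain q where q: "\<And>k. q k \<in> prox_pos_l0 \<alpha> lam (y k)"
    and close: "\<And>k. dist (x k) (q k) < e k + 1 / Suc k" by metis
  have bound: "\<forall>k. norm (q k - x k) \<le> e k + 1 / Suc k"
    using close by (simp add: dist_norm norm_minus_commute less_imp_le)
  have "(\<lambda>k. e k + 1 / Suc k) \<longlonglongrightarrow> 0"
    using tendsto_add[OF e LIMSEQ_Suc[OF lim_1_over_n]] by simp
  then have "(\<lambda>k. q k - x k) \<longlonglongrightarrow> 0"
    by (rule Lim_null_comparison[OF always_eventually[OF bound]])
  then have "q \<longlonglongrightarrow> x'"
    by (rule Lim_transform[OF x])
  then show ?thesis using prox_pos_l0_closed_graph lam q y by blast
qed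

section \<open>Perturbed descent\<close>

text \<open>
  A perturbed descent sequence can decrease only by a bounded total amount once it is bounded below
  along a subsequence: every partial sum of the decreases is dominated by one that ends at an
  index of the subsequence.
\<close>

lemma perturbed_descent_summable:
  fixes L x s :: "nat \<Rightarrow> real" and r :: "nat \<Rightarrow> nat"
  assumes descent: "\<And>k. L (Suc k) + x k \<le> L k + s k"
    and x: "\<And>k. 0 \<le> x k" and s: "\<And>k. 0 \<le> s k" and "summable s"
    and r: "strict_mono r" and below: "\<And>n. B \<le> L (r n)"
  shows "summable x"
proof (rule summableI_nonneg_bounded[OF x])
  fix N
  have telescope: "L n + (\<Sum>k<n. x k) \<le> L 0 + (\<Sum>k<n. s k)" for n
  proof (induction n)
    case (Suc n)
    then show ?case using descent[of n] by simp
  qed simp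
  have "(\<Sum>k<N. x k) \<le> (\<Sum>k<r N. x k)"
    using seq_suble[OF r, of N] x by (intro sum_mono2) auto
  also have "\<dots> \<le> L 0 + (\<Sum>k<r N. s k) - B"
    using telescope[of "r N"] below[of N] by simp
  also have "\<dots> \<le> L 0 + suminf s - B"
    using sum_le_suminf[OF \<open>summable s\<close>, of "{..<r N}"] s by simp
  finally show "(\<Sum>k<N. x k) \<le> L 0 + suminf s - B" .
qed

lemma ratio_le_sqrt_imp_summable_squares:
  fixes e :: "nat \<Rightarrow> real"
  assumes pos: "\<And>k. 0 < e k" and ratio: "\<And>k. e (Suc k) / e k \<le> sqrt q" and q: "0 \<le> q" "q < 1"
  shows "summable (\<lambda>k. (e k)\<^sup>2)"
proof (rule summable_ratio_test[OF \<open>q < 1\<close>, of 0])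
  fix k
  have "e (Suc k) \<le> sqrt q * e k"
    using ratio[of k] pos[of k] by (simp add: pos_divide_le_eq)
  then have "(e (Suc k))\<^sup>2 \<le> (sqrt q * e k)\<^sup>2"
    using pos[of "Suc k"] by (intro power_mono) auto
  then show "norm ((e (Suc k))\<^sup>2) \<le> q * norm ((e k)\<^sup>2)"
    using q by (simp add: power_mult_distrib)
qed

lemma square_sum4_le: "(a + b + c + d)\<^sup>2 \<le> 4 * (a\<^sup>2 + b\<^sup>2 + c\<^sup>2 + (d::real)\<^sup>2)"
proof -
  have "4 * (a\<^sup>2 + b\<^sup>2 + c\<^sup>2 + d\<^sup>2) - (a + b + c + d)\<^sup>2
      = (a - b)\<^sup>2 + (a - c)\<^sup>2 + (a - d)\<^sup>2 + (b - c)\<^sup>2 + (b - d)\<^sup>2 + (c - d)\<^sup>2"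
    by (simp add: power2_eq_square algebra_simps)
  also have "\<dots> \<ge> 0" by simp
  finally show ?thesis by simp
qed

text \<open>
  The multiplier moves by \<open>\<rho>\<close> times the residual it is paired with, so this step costs a square,
  while moving the proximal centre to \<open>w\<close> recovers the whole proximal term. Convergence rests on the
  balance of the two.
\<close>

lemma lyapunov_after_updates:
  "lyapunov f A b lam \<rho> \<mu> w u (z + \<rho> *\<^sub>R (A *v w + b - u)) w
     = lyapunov f A b lam \<rho> \<mu> w u z v + \<rho> * (norm (A *v w + b - u))\<^sup>2 - \<mu> / 2 * (norm (w - v))\<^sup>2"
  by (simp add: lyapunov_def inner_add_left dot_square_norm)

lemma tendsto_zero_of_summable_squares:
  fixes x :: "nat \<Rightarrow> real"
  assumes "summable (\<lambda>k. (x k)\<^sup>2)"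
  shows "x \<longlonglongrightarrow> 0"
  using tendsto_real_sqrt[OF summable_LIMSEQ_zero[OF assms]] by (simp add: tendsto_rabs_zero_iff)

section \<open>The augmented Lagrangian iteration\<close>

text \<open>
  Subtracting two approximate stationarity relations expresses \<open>A\<^sup>T (z' - z)\<close> through the changes of
  \<open>w\<close>, and a lower bound on \<open>A\<^sup>T\<close> turns this into a bound on the change of the multiplier.
\<close>

lemma multiplier_change_le:
  fixes A :: "real^'p^'n" and F :: "real^'p \<Rightarrow> real^'p"
  assumes lower: "\<And>x. \<gamma> * norm x \<le> norm (transpose A *v x)" and \<gamma>: "\<gamma> > 0" and \<mu>: "\<mu> \<ge> 0"
    and lip: "norm (F w' - F w) \<le> l * norm (w' - w)"
    and stat: "norm (F w + \<mu> *\<^sub>R (w - v) + transpose A *v z) \<le> e"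
    and stat': "norm (F w' + \<mu> *\<^sub>R (w' - w) + transpose A *v z') \<le> e'"
  shows "norm (z' - z) \<le> (\<mu> + l) / \<gamma> * norm (w' - w) + \<mu> / \<gamma> * norm (w - v) + e' / \<gamma> + e / \<gamma>"
proof -
  let ?G = "F w + \<mu> *\<^sub>R (w - v) + transpose A *v z"
  let ?G' = "F w' + \<mu> *\<^sub>R (w' - w) + transpose A *v z'"
  have "transpose A *v (z' - z) = ?G' - ?G - (F w' - F w) - \<mu> *\<^sub>R (w' - w) + \<mu> *\<^sub>R (w - v)"
    by (simp add: matrix_vector_mult_diff_distrib del: transpose_matrix_vector)
  moreover have "norm (a - b - c - d + e) \<le> norm a + norm b + norm c + norm d + norm e"
    for a b c d e :: "real^'p" by norm
  ultimately have "norm (transpose A *v (z' - z))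
      \<le> norm ?G' + norm ?G + norm (F w' - F w) + norm (\<mu> *\<^sub>R (w' - w)) + norm (\<mu> *\<^sub>R (w - v))"
    by metis
  also have "\<dots> \<le> e' + e + l * norm (w' - w) + \<mu> * norm (w' - w) + \<mu> * norm (w - v)"
    using stat stat' lip \<mu> by simp
  finally have "\<gamma> * norm (z' - z) \<le> (\<mu> + l) * norm (w' - w) + \<mu> * norm (w - v) + e' + e"
    using lower[of "z' - z"] by (simp add: algebra_simps)
  then show ?thesis using \<gamma> by (simp add: field_simps)
qed

theorem theorem6:
  fixes f :: "real^'p \<Rightarrow> real" and A :: "real^'p^'n" and b :: "real^'n"
    and lam \<rho> \<mu> \<alpha> \<beta> \<eta> \<gamma> c1 c2 l_f :: real
    and t l_g :: real and Q :: "nat \<Rightarrow> nat \<Rightarrow> real^'p^'p" and g :: "real^'p \<Rightarrow> real"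
    and \<epsilon> :: "nat \<Rightarrow> real"
    and w v :: "nat \<Rightarrow> real^'p" and u z :: "nat \<Rightarrow> real^'n"
    and w_star v_star :: "real^'p" and u_star z_star :: "real^'n"
  assumes f_C1: "continuously_differentiable f"
    and f_smooth: "l_smooth l_f f"
    and f_coercive: "coercive f"
    and A_full_row_rank: "rank A = CARD('n)"
    and \<gamma>_def: "\<gamma> = sqrt (min_eigenvalue (A ** transpose A))"
    and \<gamma>_pos: "\<gamma> > 0"
    and lam_pos: "lam > 0" and \<mu>_pos: "\<mu> > 0" and \<rho>_pos: "\<rho> > 0"
    and c1_def: "c1 = (\<mu> + l_f) / \<gamma>" and c2_def: "c2 = \<mu> / \<gamma>"
    and \<rho>_large: "\<rho> > max (16 * (c1\<^sup>2 + c2\<^sup>2) / \<mu>) (6 * l_f / \<gamma>\<^sup>2)"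
    and \<alpha>_def: "\<alpha> = 1 / \<rho>"
    and \<beta>_def: "\<beta> = 8 * c2\<^sup>2 / \<rho>"
    and \<eta>_large: "\<eta> > 4 / (\<rho> * \<gamma>\<^sup>2)"
    and \<epsilon>_pos: "\<And>k. \<epsilon> k > 0"
    and \<epsilon>_ratio: "\<And>k. \<epsilon> (Suc k) / \<epsilon> k \<le> sqrt ((\<rho> * \<gamma>\<^sup>2 * \<eta> - 4) / (\<rho> * \<gamma>\<^sup>2 * \<eta> + 4))"
    and t_pos: "t > 0"
    and Q_psd: "\<And>k j. sym_psd (Q k j)"
    and g_smooth: "l_smooth l_g g"
    and generated: "ialm_sequence f A b lam \<rho> \<mu> \<alpha> t Q g \<epsilon> w u z v"
    and accumulation: "accumulation_point (\<lambda>k. (w k, u k, z k, v k)) (w_star, u_star, z_star, v_star)"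
  shows "v_star = w_star \<and> P_stationary f A b lam w_star u_star z_star"
proof -
  define D where "D k = norm (w (Suc k) - v k)" for k
  define R where "R k = A *v w (Suc k) + b - u (Suc k)" for k
  define V where "V k = lyapunov f A b lam \<rho> \<mu> (w k) (u k) (z k) (v k)" for k
  have step: "ialm_primal_step f A b lam \<rho> \<mu> \<alpha> t Q g \<epsilon> w u z v k" for k
    using generated unfolding ialm_sequence_def by blast
  have z_Suc: "z (Suc k) = z k + \<rho> *\<^sub>R R k" and v_Suc: "v (Suc k) = w (Suc k)" for k
    using generated unfolding ialm_sequence_def R_def by blast+
  have diff: "f differentiable at x" for x
    using f_smooth unfolding l_smooth_def by blast
  have grad_w: "grad_w (smooth_part f A b \<rho> \<mu> (z k) (v k)) (w (Suc k)) (u (Suc k))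
                  = grad f (w (Suc k)) + \<mu> *\<^sub>R (w (Suc k) - v k) + transpose A *v z (Suc k)"
    and grad_u: "grad_u (smooth_part f A b \<rho> \<mu> (z k) (v k)) (w (Suc k)) (u (Suc k))
                  = - z (Suc k)" for k
    by (simp_all only: grad_w_smooth_part[OF diff] grad_u_smooth_part z_Suc R_def)
  have decrease: "lyapunov f A b lam \<rho> \<mu> (w (Suc k)) (u (Suc k)) (z k) (v k) \<le> V k"
    and stationary_u: "infdist (u (Suc k)) (prox_pos_l0 \<alpha> lam (u (Suc k) + \<alpha> *\<^sub>R z (Suc k))) \<le> \<epsilon> k"
    and stationary_w: "norm (grad f (w (Suc k)) + \<mu> *\<^sub>R (w (Suc k) - v k)
                         + transpose A *v z (Suc k)) \<le> \<epsilon> k" for k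
    using step[of k] unfolding ialm_primal_step_def Let_def
    by (simp_all add: V_def grad_w grad_u del: transpose_matrix_vector)

  have dz: "norm (z (Suc (Suc k)) - z (Suc k))
              \<le> c1 * D (Suc k) + c2 * D k + \<epsilon> (Suc k) / \<gamma> + \<epsilon> k / \<gamma>" for k
    unfolding c1_def c2_def D_def v_Suc
  proof (rule multiplier_change_le[where A = A and F = "grad f"])
    show "\<gamma> * norm x \<le> norm (transpose A *v x)" for x
      unfolding \<gamma>_def by (rule norm_transpose_lower_bound)
    show "norm (grad f (w (Suc (Suc k))) - grad f (w (Suc k)))
            \<le> l_f * norm (w (Suc (Suc k)) - w (Suc k))"
      using f_smooth unfolding l_smooth_def by (auto simp: lipschitz_on_def dist_norm)
    show "norm (grad f (w (Suc k)) + \<mu> *\<^sub>R (w (Suc k) - v k) + transpose A *v z (Suc k)) \<le> \<epsilon> k"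
      by (rule stationary_w)
    show "norm (grad f (w (Suc (Suc k))) + \<mu> *\<^sub>R (w (Suc (Suc k)) - w (Suc k))
            + transpose A *v z (Suc (Suc k))) \<le> \<epsilon> (Suc k)"
      using stationary_w[of "Suc k"] unfolding v_Suc .
  qed (use \<gamma>_pos \<mu>_pos in auto)

  have sum_eps: "summable (\<lambda>k. (\<epsilon> k)\<^sup>2)"
  proof (rule ratio_le_sqrt_imp_summable_squares[where e = \<epsilon>, OF \<epsilon>_pos \<epsilon>_ratio])
    have "4 < \<rho> * \<gamma>\<^sup>2 * \<eta>"
      using \<eta>_large \<rho>_pos \<gamma>_pos by (simp add: field_simps)
    then show "0 \<le> (\<rho> * \<gamma>\<^sup>2 * \<eta> - 4) / (\<rho> * \<gamma>\<^sup>2 * \<eta> + 4)"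
      "(\<rho> * \<gamma>\<^sup>2 * \<eta> - 4) / (\<rho> * \<gamma>\<^sup>2 * \<eta> + 4) < 1" by simp_all
  qed
  have eps: "\<epsilon> \<longlonglongrightarrow> 0" by (rule tendsto_zero_of_summable_squares[OF sum_eps])

  \<comment> \<open>The multiplier bound at step \<open>k + 1\<close> also involves the earlier \<open>D k\<close>; the extra term of \<open>L\<close>
    pays for it one step ahead. Each coefficient 4 comes from squaring a sum of four terms.\<close>
  define L where "L k = V (Suc k) + 4 * c2\<^sup>2 / \<rho> * (D k)\<^sup>2" for k
  define \<delta> where "\<delta> = \<mu> / 2 - 4 * (c1\<^sup>2 + c2\<^sup>2) / \<rho>"
  define s where "s k = 4 / \<rho> * ((\<epsilon> (Suc k) / \<gamma>)\<^sup>2 + (\<epsilon> k / \<gamma>)\<^sup>2)" for k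
  have \<delta>: "\<delta> > 0"
  proof -
    have "16 * (c1\<^sup>2 + c2\<^sup>2) < \<rho> * \<mu>"
      using \<rho>_large \<mu>_pos by (simp add: field_simps)
    moreover have "0 < \<rho> * \<mu>" using \<rho>_pos \<mu>_pos by simp
    ultimately have "8 * (c1\<^sup>2 + c2\<^sup>2) < \<rho> * \<mu>" by linarith
    then show ?thesis using \<rho>_pos by (simp add: \<delta>_def field_simps)
  qed
  have descent: "L (Suc k) + \<delta> * (D (Suc k))\<^sup>2 \<le> L k + s k" for k
  proof -
    have "\<rho> * (norm (R (Suc k)))\<^sup>2 = 1 / \<rho> * (norm (z (Suc (Suc k)) - z (Suc k)))\<^sup>2"
      unfolding z_Suc[of "Suc k"] using \<rho>_pos by (simp add: power_mult_distrib power2_eq_square)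
    also have "\<dots> \<le> 1 / \<rho> * (c1 * D (Suc k) + c2 * D k + \<epsilon> (Suc k) / \<gamma> + \<epsilon> k / \<gamma>)\<^sup>2"
      using dz[of k] \<rho>_pos by (intro mult_left_mono power_mono) auto
    also have "\<dots> \<le> 1 / \<rho> * (4 * ((c1 * D (Suc k))\<^sup>2 + (c2 * D k)\<^sup>2
                                   + (\<epsilon> (Suc k) / \<gamma>)\<^sup>2 + (\<epsilon> k / \<gamma>)\<^sup>2))"
      using \<rho>_pos by (intro mult_left_mono square_sum4_le) auto
    also have "\<dots> = 4 * c1\<^sup>2 / \<rho> * (D (Suc k))\<^sup>2 + 4 * c2\<^sup>2 / \<rho> * (D k)\<^sup>2 + s k"
      by (simp add: s_def power_mult_distrib add_divide_distrib distrib_left)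
    finally have residual: "\<rho> * (norm (R (Suc k)))\<^sup>2
      \<le> 4 * c1\<^sup>2 / \<rho> * (D (Suc k))\<^sup>2 + 4 * c2\<^sup>2 / \<rho> * (D k)\<^sup>2 + s k" .
    have "V (Suc (Suc k)) \<le> V (Suc k) + \<rho> * (norm (R (Suc k)))\<^sup>2 - \<mu> / 2 * (D (Suc k))\<^sup>2"
      using decrease[of "Suc k"]
        lyapunov_after_updates[of f A b lam \<rho> \<mu> "w (Suc (Suc k))" "u (Suc (Suc k))"
          "z (Suc k)" "v (Suc k)"]
      by (simp add: V_def z_Suc v_Suc R_def D_def)
    moreover have "\<delta> * (D (Suc k))\<^sup>2 = \<mu> / 2 * (D (Suc k))\<^sup>2
        - 4 * c1\<^sup>2 / \<rho> * (D (Suc k))\<^sup>2 - 4 * c2\<^sup>2 / \<rho> * (D (Suc k))\<^sup>2"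
      by (simp add: \<delta>_def algebra_simps add_divide_distrib)
    ultimately show ?thesis using residual by (simp add: L_def)
  qed

  obtain r where r: "strict_mono r"
    and lim: "((\<lambda>k. (w k, u k, z k, v k)) \<circ> r) \<longlonglongrightarrow> (w_star, u_star, z_star, v_star)"
    using accumulation unfolding accumulation_point_def by blast
  \<comment> \<open>Dropping the first index makes every index of the subsequence a successor, so that the
    relations produced by an iteration apply to it.\<close>
  define m where "m n = r (Suc n) - 1" for n
  have r_Suc: "r (Suc n) = Suc (m n)" for n
    using seq_suble[OF r, of "Suc n"] by (simp add: m_def)
  have m: "strict_mono m"
    unfolding strict_mono_Suc_iff using r[unfolded strict_mono_Suc_iff] r_Suc by (metis Suc_less_eq)
  have lim: "(\<lambda>n. (w (Suc (m n)), u (Suc (m n)), z (Suc (m n)), v (Suc (m n))))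
               \<longlonglongrightarrow> (w_star, u_star, z_star, v_star)"
    using LIMSEQ_Suc[OF lim] by (simp add: r_Suc)
  have w_lim: "(\<lambda>n. w (Suc (m n))) \<longlonglongrightarrow> w_star" using tendsto_fst[OF lim] by simp
  have u_lim: "(\<lambda>n. u (Suc (m n))) \<longlonglongrightarrow> u_star" using tendsto_fst[OF tendsto_snd[OF lim]] by simp
  have z_lim: "(\<lambda>n. z (Suc (m n))) \<longlonglongrightarrow> z_star"
    using tendsto_fst[OF tendsto_snd[OF tendsto_snd[OF lim]]] by simp
  have v_lim: "(\<lambda>n. v (Suc (m n))) \<longlonglongrightarrow> v_star"
    using tendsto_snd[OF tendsto_snd[OF tendsto_snd[OF lim]]] by simp
  have v_star: "v_star = w_star"
    using LIMSEQ_unique[OF v_lim] w_lim by (simp add: v_Suc)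

  have A_lim: "(\<lambda>n. A *v w (Suc (m n))) \<longlonglongrightarrow> A *v w_star"
    by (rule bounded_linear.tendsto[OF matrix_vector_mul_bounded_linear w_lim])
  have At_lim: "(\<lambda>n. transpose A *v z (Suc (m n))) \<longlonglongrightarrow> transpose A *v z_star"
    by (rule bounded_linear.tendsto[OF matrix_vector_mul_bounded_linear z_lim])
  have f_lim: "(\<lambda>n. f (w (Suc (m n)))) \<longlonglongrightarrow> f w_star"
    using differentiable_imp_continuous_within[OF diff] w_lim by (rule isCont_tendsto_compose)

  \<comment> \<open>Without the counting term, which is nonnegative, the Lyapunov function is continuous.\<close>
  define H where "H n = smooth_part f A b \<rho> \<mu> (z (Suc (m n))) (v (Suc (m n)))
                          (w (Suc (m n))) (u (Suc (m n)))" for n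
  have "H \<longlonglongrightarrow> smooth_part f A b \<rho> \<mu> z_star v_star w_star u_star"
    unfolding H_def smooth_part_def by (intro tendsto_intros f_lim A_lim w_lim u_lim z_lim v_lim)
  then have "Bseq H" using convergent_imp_Bseq convergentI by blast
  then obtain K where K: "\<And>n. \<bar>H n\<bar> \<le> K" unfolding Bseq_def real_norm_def by blast
  define B where "B = - K"
  have B: "B \<le> H n" for n using K[of n] unfolding B_def by linarith
  have below: "B \<le> L (m n)" for n
  proof -
    have "V (Suc (m n)) = H n + lam * real (l0_norm (pos_part (u (Suc (m n)))))"
      by (simp add: V_def H_def lyapunov_def smooth_part_def)
    moreover have "0 \<le> 4 * c2\<^sup>2 / \<rho> * (D (m n))\<^sup>2" using \<rho>_pos by simp
    moreover have "0 \<le> lam * real (l0_norm (pos_part (u (Suc (m n)))))" using lam_pos by simp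
    ultimately show ?thesis using B[of n] by (simp add: L_def)
  qed

  have "summable s"
    unfolding s_def power_divide
    by (intro summable_mult summable_add summable_divide sum_eps
        summable_Suc_iff[of "\<lambda>k. (\<epsilon> k)\<^sup>2", THEN iffD2])
  moreover have "0 \<le> s k" for k using \<rho>_pos by (simp add: s_def)
  moreover have "0 \<le> \<delta> * (D (Suc k))\<^sup>2" for k using \<delta> by simp
  ultimately have "summable (\<lambda>k. \<delta> * (D (Suc k))\<^sup>2)"
    using perturbed_descent_summable[OF descent _ _ _ m below] by blast
  then have "summable (\<lambda>k. (D (Suc k))\<^sup>2)"
    using \<delta> by (simp add: summable_cmult_iff)
  then have D_Suc: "(\<lambda>k. D (Suc k)) \<longlonglongrightarrow> 0"
    by (rule tendsto_zero_of_summable_squares)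
  then have D: "D \<longlonglongrightarrow> 0" by (rule LIMSEQ_imp_Suc)

  have "(\<lambda>k. c1 * D (Suc k) + c2 * D k + \<epsilon> (Suc k) / \<gamma> + \<epsilon> k / \<gamma>)
          \<longlonglongrightarrow> c1 * 0 + c2 * 0 + 0 / \<gamma> + 0 / \<gamma>"
    using \<gamma>_pos by (intro tendsto_add tendsto_mult tendsto_divide tendsto_const
        D_Suc D eps LIMSEQ_Suc[OF eps]) simp_all
  then have "(\<lambda>k. c1 * D (Suc k) + c2 * D k + \<epsilon> (Suc k) / \<gamma> + \<epsilon> k / \<gamma>) \<longlonglongrightarrow> 0"
    by simp
  then have "(\<lambda>k. z (Suc (Suc k)) - z (Suc k)) \<longlonglongrightarrow> 0"
    by (rule Lim_null_comparison[OF always_eventually[OF allI[OF dz]]])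
  then have "(\<lambda>k. (1 / \<rho>) *\<^sub>R (z (Suc (Suc k)) - z (Suc k))) \<longlonglongrightarrow> (1 / \<rho>) *\<^sub>R 0"
    by (intro tendsto_intros)
  then have "(\<lambda>k. R (Suc k)) \<longlonglongrightarrow> 0"
    using \<rho>_pos by (simp add: z_Suc[of "Suc _"])
  then have "R \<longlonglongrightarrow> 0" by (rule LIMSEQ_imp_Suc)
  then have "(\<lambda>n. R (m n)) \<longlonglongrightarrow> 0"
    using LIMSEQ_subseq_LIMSEQ[OF _ m] by (simp add: o_def)
  moreover have "(\<lambda>n. R (m n)) \<longlonglongrightarrow> A *v w_star + b - u_star"
    unfolding R_def by (intro tendsto_intros A_lim u_lim)
  ultimately have feasible: "A *v w_star + b - u_star = 0"
    by (metis LIMSEQ_unique)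

  have eps_m: "(\<lambda>n. \<epsilon> (m n)) \<longlonglongrightarrow> 0"
    using LIMSEQ_subseq_LIMSEQ[OF eps m] by (simp add: o_def)
  have D_m: "(\<lambda>n. w (Suc (m n)) - v (m n)) \<longlonglongrightarrow> 0"
    using LIMSEQ_subseq_LIMSEQ[OF D m] unfolding D_def o_def by (rule tendsto_norm_zero_cancel)
  have "isCont (grad f) w_star"
    using f_C1 unfolding continuously_differentiable_def by (simp add: continuous_on_eq_continuous_at)
  then have "(\<lambda>n. grad f (w (Suc (m n)))) \<longlonglongrightarrow> grad f w_star"
    using w_lim by (rule isCont_tendsto_compose)
  then have "(\<lambda>n. grad f (w (Suc (m n))) + \<mu> *\<^sub>R (w (Suc (m n)) - v (m n))
                   + transpose A *v z (Suc (m n)))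
               \<longlonglongrightarrow> grad f w_star + \<mu> *\<^sub>R 0 + transpose A *v z_star"
    by (intro tendsto_add tendsto_scaleR tendsto_const D_m At_lim)
  moreover have "(\<lambda>n. grad f (w (Suc (m n))) + \<mu> *\<^sub>R (w (Suc (m n)) - v (m n))
                   + transpose A *v z (Suc (m n))) \<longlonglongrightarrow> 0"
    using eps_m by (rule Lim_null_comparison[OF always_eventually[OF allI[OF stationary_w]]])
  ultimately have "grad f w_star + \<mu> *\<^sub>R 0 + transpose A *v z_star = 0"
    by (rule LIMSEQ_unique)
  then have dual: "grad f w_star + transpose A *v z_star = 0"
    by (simp del: transpose_matrix_vector)

  have \<alpha>_pos: "\<alpha> > 0" using \<rho>_pos by (simp add: \<alpha>_def)
  have "(\<lambda>n. u (Suc (m n)) + \<alpha> *\<^sub>R z (Suc (m n))) \<longlonglongrightarrow> u_star + \<alpha> *\<^sub>R z_star"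
    by (intro tendsto_intros u_lim z_lim)
  then have "u_star \<in> prox_pos_l0 \<alpha> lam (u_star + \<alpha> *\<^sub>R z_star)"
    using approximate_prox_fixed_point_limit[OF _ \<alpha>_pos stationary_u eps_m u_lim] lam_pos by simp
  with dual feasible \<alpha>_pos have "P_stationary f A b lam w_star u_star z_star"
    unfolding P_stationary_def by blast
  with v_star show ?thesis by blast
qed

end
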